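(* (i) If $f(z)=z+a_2z^2+a_3z^3+\cdots\in\mathcal{S}^*_{Ne}$, then $|a_2|\leq1$, $|a_3|\leq\frac12$, and for any complex number $\mu$, $$|a_3-\mu a_2^2|\leq\frac{1}{2}\max\left\{1,|2\mu-1|\right\}.$$ In particular, $|a_3-a_2^2|\leq\frac12$. Equality holds in $|a_2|\le 1$, $|a_3|\le\frac12$ and $|a_3-a_2^2|\le\frac12$ for the function $f_{Ne}(z)=ze^{z-z^3/9}$. (ii) If $f(z)=z+a_2z^2+a_3z^3+\cdots\in\mathcal{C}_{Ne}$, then $|a_2|\leq\frac12$ and $|a_3|\leq\frac16$. Equality holds for the function $\widehat{f}_{Ne}(z)=\int_0^z e^{\zeta-\zeta^3/9}\,d\zeta$. Further, for any complex number $\mu$, $$|a_3-\mu a_2^2|\leq\frac{1}{6}\max\left\{1,\left|\frac{3}{2}\mu-1\right|\right\}.$$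
   Context: $\mathbb{D}$ is the open unit disk. $\mathcal{A}$ is the set of analytic functions $f$ on $\mathbb{D}$ with $f(0)=0$ and $f'(0)=1$. For analytic $f,g$ on $\mathbb{D}$, $f\prec g$ means there is an analytic $w$ on $\mathbb{D}$ with $w(0)=0$, $|w(z)|<1$ and $f(z)=g(w(z))$ on $\mathbb{D}$. With $\varphi_{Ne}(z)=1+z-z^3/3$: $\mathcal{S}^*_{Ne}=\{f\in\mathcal{A}: zf'(z)/f(z)\prec\varphi_{Ne}(z)\}$ and $\mathcal{C}_{Ne}=\{f\in\mathcal{A}: 1+zf''(z)/f'(z)\prec\varphi_{Ne}(z)\}$. *)

theory Defs
  imports "HOL-Complex_Analysis.Complex_Analysis"
begin

abbreviation unit_disk :: "complex set" where
  "unit_disk \<equiv> ball 0 1"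

definition normalized_analytic :: "(complex \<Rightarrow> complex) set" where
  "normalized_analytic = {f. f holomorphic_on unit_disk \<and> f 0 = 0 \<and> deriv f 0 = 1}"

definition subordinate :: "(complex \<Rightarrow> complex) \<Rightarrow> (complex \<Rightarrow> complex) \<Rightarrow> bool" where
  "subordinate f g \<longleftrightarrow>
     f holomorphic_on unit_disk \<and> g holomorphic_on unit_disk \<and>
     (\<exists>w. w holomorphic_on unit_disk \<and> w 0 = 0 \<and>
          (\<forall>z\<in>unit_disk. norm (w z) < 1 \<and> f z = g (w z)))"

definition phi_Ne :: "complex \<Rightarrow> complex" where
  "phi_Ne z = 1 + z - z ^ 3 / 3"

text \<open>
  For normalized \<open>f\<close> the quotient \<open>z f'(z) / f(z)\<close> has a removable singularity
  at \<open>0\<close>, where its value is \<open>1\<close>. At any other zero of \<open>f\<close> (for the second quotient: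
  at any zero of \<open>f'\<close>) in the disk there is a genuine pole, so the total function below,
  whatever the value of division by zero, is not holomorphic there. Since subordination
  demands holomorphy, membership in the classes below includes that the quotients are
  defined on the whole disk.
\<close>

definition starlike_quotient :: "(complex \<Rightarrow> complex) \<Rightarrow> complex \<Rightarrow> complex" where
  "starlike_quotient f z = (if z = 0 then 1 else z * deriv f z / f z)"

definition convex_quotient :: "(complex \<Rightarrow> complex) \<Rightarrow> complex \<Rightarrow> complex" where
  "convex_quotient f z = 1 + z * deriv (deriv f) z / deriv f z"

definition starlike_Ne :: "(complex \<Rightarrow> complex) set" where
  "starlike_Ne = {f \<in> normalized_analytic. subordinate (starlike_quotient f) phi_Ne}"

definition convex_Ne :: "(complex \<Rightarrow> complex) set" where
  "convex_Ne = {f \<in> normalized_analytic. subordinate (convex_quotient f) phi_Ne}"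

definition taylor_coeff :: "(complex \<Rightarrow> complex) \<Rightarrow> nat \<Rightarrow> complex" where
  "taylor_coeff f n = fps_nth (fps_expansion f 0) n"

definition f_Ne :: "complex \<Rightarrow> complex" where
  "f_Ne z = z * exp (z - z ^ 3 / 9)"

definition f_hat_Ne :: "complex \<Rightarrow> complex" where
  "f_hat_Ne z = contour_integral (linepath 0 z) (\<lambda>t. exp (t - t ^ 3 / 9))"

end

(*
  If f corresponds to the Schwarz function w(z) = c1 z + c2 z^2 + ..., comparing coefficients in
  z f' = f (1 + w - w^3/3), resp. z f'' = f' (w - w^3/3), gives a2 = c1, a3 = (c2 + c1^2)/2,
  resp. a2 = c1/2, a3 = (c2 + c1^2)/6; the cubic term is of too high order to contribute.
  All bounds then follow from |c2 - t c1^2| <= max 1 |t|, a consequence of |c2| <= 1 - |c1|^2,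
  which is the Schwarz-Pick inequality for w(z)/z at 0.  The extremal functions have w(z) = z.
*)
theory Submission
  imports Defs
begin

section \<open>Taylor coefficients and power series expansions at the origin\<close>

lemma taylor_coeff_deriv: "taylor_coeff f n = (deriv ^^ n) f 0 / fact n"
  by (simp add: taylor_coeff_def fps_expansion_def)

lemma taylor_coeff_eqI:
  "f has_fps_expansion F \<Longrightarrow> taylor_coeff f n = fps_nth F n"
  by (metis analytic_at_imp_has_fps_expansion_0 has_fps_expansion_imp_analytic_0
      fps_expansion_unique_complex taylor_coeff_def)

lemma has_fps_expansion_unit_disk:
  "f holomorphic_on unit_disk \<Longrightarrow> f has_fps_expansion fps_expansion f 0"
  by (rule has_fps_expansion_fps_expansion[of unit_disk]) auto

text \<open>Turns a functional equation near 0 into an identity of formal power series, from which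
  coefficients can be read off. Agreement near 0 suffices, so the quotients only have to be cleared
  of denominators there.\<close>

lemma has_fps_expansion_eq_nhds:
  assumes "f has_fps_expansion F" "g has_fps_expansion G" "\<forall>\<^sub>F z in nhds 0. f z = g z"
  shows "F = (G :: complex fps)"
  using assms has_fps_expansion_cong[OF assms(3) refl, of F] fps_expansion_unique_complex by blast

lemma eventually_unit_disk: "\<forall>\<^sub>F z in nhds 0. z \<in> unit_disk"
  by (rule eventually_nhds_in_open) auto

section \<open>Coefficient bounds for Schwarz functions\<close>

text \<open>If \<open>norm (g a) = 1\<close> at some point of the disk, then \<open>g\<close> is
  constant by the maximum modulus principle. Otherwise the disk automorphism taking
  \<open>g 0\<close> to 0, composed with \<open>g\<close>, satisfies the Schwarz lemma, and the
  chain rule yields the bound. The non-strict hypothesis covers \<open>w z / z\<close> for a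
  rotation \<open>w\<close>, where the modulus is identically 1.\<close>

lemma Schwarz_Pick_at_0:
  assumes hol: "g holomorphic_on unit_disk"
    and le: "\<And>z. z \<in> unit_disk \<Longrightarrow> norm (g z) \<le> 1"
  shows "norm (deriv g 0) \<le> 1 - (norm (g 0))\<^sup>2"
proof (cases "\<exists>a\<in>unit_disk. norm (g a) = 1")
  case True
  then obtain a where a: "a \<in> unit_disk" "norm (g a) = 1" by blast
  have "g constant_on unit_disk"
    by (rule maximum_modulus_principle[OF hol, where U = unit_disk and \<xi> = a])
       (use a le in auto)
  then obtain c where c: "\<And>z. z \<in> unit_disk \<Longrightarrow> g z = c"
    by (auto simp: constant_on_def)
  have "deriv g 0 = deriv (\<lambda>_. c) 0"
    by (rule deriv_cong_ev) (use c in \<open>auto intro: eventually_mono[OF eventually_unit_disk]\<close>)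
  moreover have "norm (g 0) = 1"
    using a c[of a] c[of 0] by simp
  ultimately show ?thesis by simp
next
  case False
  then have lt: "norm (g z) < 1" if "norm z < 1" for z
    using le[of z] that by force
  define c where "c = g 0"
  have c: "norm c < 1" using lt[of 0] by (simp add: c_def)
  define m where "m = Moebius_function 0 c"
  have m: "m holomorphic_on unit_disk"
    unfolding m_def by (rule Moebius_function_holomorphic[OF c])
  have hol': "(\<lambda>z. m (g z)) holomorphic_on unit_disk"
    using holomorphic_on_compose_gen[OF hol m] lt by (force simp: o_def)
  have "norm (deriv (\<lambda>z. m (g z)) 0) \<le> 1"
    using Schwarz_Lemma(2)[OF hol', of 0] Moebius_function_norm_lt_1[OF c lt]
    by (simp add: m_def c_def Moebius_function_eq_zero)
  moreover have "deriv (\<lambda>z. m (g z)) 0 = deriv m c * deriv g 0"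
    using deriv_chain[of g 0 m] hol m c
    by (auto simp: c_def o_def holomorphic_on_imp_differentiable_at)
  \<comment> \<open>In the quotient rule for \<open>(z - c) / (1 - cnj c * z)\<close> the numerator
    vanishes at \<open>c\<close>, so only \<open>1 / (1 - cnj c * c)\<close> survives.\<close>
  moreover have "deriv m c = of_real (1 / (1 - (norm c)\<^sup>2))"
  proof -
    have ne: "1 - cnj c * c \<noteq> 0"
    proof
      assume "1 - cnj c * c = 0"
      then have "norm (cnj c * c) = 1" by simp
      moreover have "norm (cnj c * c) < 1"
        using c norm_mult_less[of "cnj c" 1 c 1] by simp
      ultimately show False by simp
    qed
    have "m = (\<lambda>z. (z - c) / (1 - cnj c * z))"
      by (simp add: m_def Moebius_function_simple fun_eq_iff)
    then have "(m has_field_derivative 1 / (1 - cnj c * c)) (at c)"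
      using ne by (auto intro!: derivative_eq_intros)
    then show ?thesis
      by (metis DERIV_imp_deriv complex_norm_square mult.commute of_real_1 of_real_diff of_real_divide)
  qed
  ultimately have "\<bar>1 / (1 - (norm c)\<^sup>2)\<bar> * norm (deriv g 0) \<le> 1"
    by (simp only: norm_mult norm_of_real)
  moreover have "1 - (norm c)\<^sup>2 > 0"
    using c by (simp add: power_less_one_iff)
  ultimately show ?thesis
    by (simp add: c_def pos_divide_le_eq)
qed

text \<open>Dividing \<open>w\<close> by \<open>z\<close> shifts its Taylor coefficients down by
  one, so the claim is the Schwarz-Pick bound at 0 for the quotient \<open>g\<close>.\<close>

lemma Schwarz_coeff_2:
  assumes hol: "w holomorphic_on unit_disk" and "w 0 = 0"
    and lt: "\<forall>z\<in>unit_disk. norm (w z) < 1"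
  shows "norm (taylor_coeff w 2) \<le> 1 - (norm (taylor_coeff w 1))\<^sup>2"
proof -
  obtain g where g: "g holomorphic_on unit_disk"
    and wg: "\<And>z. norm z < 1 \<Longrightarrow> w z = z * g z"
    using Schwarz3[OF hol \<open>w 0 = 0\<close>] by blast
  have le: "norm (g z) \<le> 1" if z: "z \<in> unit_disk" for z
  proof (cases "z = 0")
    case False
    then show ?thesis
      using Schwarz_Lemma(1)[OF hol \<open>w 0 = 0\<close>, of z] lt z wg[of z]
      by (simp add: norm_mult)
  next
    \<comment> \<open>The estimate of \<open>w z\<close> by \<open>z\<close> is void at 0; here
      \<open>g 0\<close> equals \<open>deriv w 0\<close>, which the derivative part of the Schwarz
      lemma bounds.\<close>
    case True
    have "norm (deriv w 0) \<le> 1"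
      using Schwarz_Lemma(2)[OF hol \<open>w 0 = 0\<close>, of 0] lt by simp
    moreover have "deriv w 0 = deriv (\<lambda>z. z * g z) 0"
      by (rule deriv_cong_ev) (use wg in \<open>auto intro: eventually_mono[OF eventually_unit_disk]\<close>)
    moreover have "deriv (\<lambda>z. z * g z) 0 = g 0"
      using g by (simp add: holomorphic_on_imp_differentiable_at[of g unit_disk])
    ultimately show ?thesis using True by simp
  qed
  have "fps_expansion w 0 = fps_X * fps_expansion g 0"
    by (rule has_fps_expansion_eq_nhds[OF has_fps_expansion_unit_disk[OF hol],
          where g = "\<lambda>z. z * g z"])
       (use g wg in \<open>auto intro!: fps_expansion_intros has_fps_expansion_unit_disk
          intro: eventually_mono[OF eventually_unit_disk]\<close>)
  then have "taylor_coeff w (Suc n) = taylor_coeff g n" for n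
    by (simp add: taylor_coeff_def)
  from this[of 0] this[of 1] have "taylor_coeff w 1 = g 0" "taylor_coeff w 2 = deriv g 0"
    by (simp_all add: taylor_coeff_deriv[of g] numeral_2_eq_2)
  with Schwarz_Pick_at_0[OF g le] show ?thesis by simp
qed

lemma Schwarz_coeff_1:
  assumes "w holomorphic_on unit_disk" "w 0 = 0" "\<forall>z\<in>unit_disk. norm (w z) < 1"
  shows "norm (taylor_coeff w 1) \<le> 1"
  using Schwarz_Lemma(2)[OF assms(1,2), of 0] assms(3) by (simp add: taylor_coeff_deriv)

text \<open>With \<open>b\<close> the squared modulus of the first coefficient, the triangle
  inequality and the bound on the second coefficient give a convex combination of 1 and
  \<open>norm t\<close> with weights \<open>1 - b\<close> and \<open>b\<close>, hence at most their
  maximum.\<close>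

lemma Schwarz_Fekete_Szego:
  assumes "w holomorphic_on unit_disk" "w 0 = 0" "\<forall>z\<in>unit_disk. norm (w z) < 1"
  shows "norm (taylor_coeff w 2 - t * (taylor_coeff w 1)\<^sup>2) \<le> max 1 (norm t)"
proof -
  define b where "b = (norm (taylor_coeff w 1))\<^sup>2"
  have b: "0 \<le> b" "b \<le> 1"
    using Schwarz_coeff_1[OF assms] by (simp_all add: b_def power_le_one)
  have "norm (taylor_coeff w 2 - t * (taylor_coeff w 1)\<^sup>2)
      \<le> norm (taylor_coeff w 2) + norm t * b"
    using norm_triangle_ineq4[of "taylor_coeff w 2" "t * (taylor_coeff w 1)\<^sup>2"]
    by (simp add: norm_mult norm_power b_def)
  also have "\<dots> \<le> (1 - b) * 1 + b * norm t"
    using Schwarz_coeff_2[OF assms] by (simp add: b_def)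
  also have "\<dots> \<le> (1 - b) * max 1 (norm t) + b * max 1 (norm t)"
    using b by (intro add_mono mult_left_mono) auto
  finally show ?thesis by (simp add: algebra_simps)
qed

section \<open>Coefficients of \<open>f\<close> in terms of those of \<open>w\<close>\<close>

text \<open>Coefficients 2 and 3 of \<open>z f' = f (1 + w - w^3/3)\<close> determine those of
  \<open>f\<close>. The lemma serves both the bounds for the class and, with \<open>w\<close> the
  identity, the extremal function.\<close>

lemma starlike_coeffs:
  assumes f: "f \<in> normalized_analytic" and w: "w holomorphic_on unit_disk" "w 0 = 0"
    and q: "\<forall>z\<in>unit_disk. starlike_quotient f z = phi_Ne (w z)"
  shows "taylor_coeff f 2 = taylor_coeff w 1"
    and "taylor_coeff f 3 = (taylor_coeff w 2 + (taylor_coeff w 1)\<^sup>2) / 2"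
proof -
  define F where "F = fps_expansion f 0"
  define W where "W = fps_expansion w 0"
  have F: "f has_fps_expansion F" and W: "w has_fps_expansion W"
    using f w by (auto simp: F_def W_def normalized_analytic_def
        intro!: has_fps_expansion_unit_disk)
  have nth: "fps_nth F 0 = 0" "fps_nth F 1 = 1" "fps_nth W 0 = 0"
    using f w by (auto simp: F_def W_def fps_expansion_def normalized_analytic_def)
  have "(f has_field_derivative 1) (at 0)"
    using f holomorphic_derivI[of f unit_disk 0] by (simp add: normalized_analytic_def)
  \<comment> \<open>A simple zero is isolated: \<open>f z / z\<close> tends to 1, so
    \<open>f\<close> has no other zero near 0 and the quotient can be multiplied out there.\<close>
  then have "((\<lambda>z. f z / z) \<longlongrightarrow> 1) (at 0)"
    using f by (simp add: has_field_derivative_iff normalized_analytic_def)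
  then have "\<forall>\<^sub>F z in at 0. f z / z \<noteq> 0"
    by (rule tendsto_imp_eventually_ne) simp
  then have "\<forall>\<^sub>F z in at 0. f z \<noteq> 0"
    by (rule eventually_mono) auto
  then have ev: "\<forall>\<^sub>F z in nhds 0. z \<noteq> 0 \<longrightarrow> f z \<noteq> 0"
    by (simp add: eventually_at_filter)
  have "fps_X * fps_deriv F = F * (1 + W - fps_const (1/3) * W ^ 3)"
  proof (rule has_fps_expansion_eq_nhds)
    show "(\<lambda>z. z * deriv f z) has_fps_expansion fps_X * fps_deriv F"
      by (intro fps_expansion_intros F)
    show "(\<lambda>z. f z * (1 + w z - 1/3 * w z ^ 3)) has_fps_expansion
        F * (1 + W - fps_const (1/3) * W ^ 3)"
      by (intro fps_expansion_intros F W)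
    show "\<forall>\<^sub>F z in nhds 0. z * deriv f z = f z * (1 + w z - 1/3 * w z ^ 3)"
      using ev eventually_unit_disk
    proof eventually_elim
      case (elim z)
      then show ?case
        using bspec[OF q elim(2)] f
        \<comment> \<open>At 0 the quotient has its assigned value, but both sides vanish because
          \<open>f 0 = 0\<close>.\<close>
        by (cases "z = 0")
           (auto simp: starlike_quotient_def phi_Ne_def normalized_analytic_def divide_simps
             mult.commute)
    qed
  qed
  \<comment> \<open>The cube is kept opaque: only the vanishing of its coefficients 0, 1 and 2
    matters, as its coefficient 3 meets the factor \<open>fps_nth F 0 = 0\<close>.\<close>
  moreover define C where "C = W ^ 3"
  ultimately have eq: "fps_nth (fps_X * fps_deriv F) n
      = fps_nth (F * (1 + W - fps_const (1/3) * C)) n" for n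
    by simp
  have cube: "fps_nth C 0 = 0" "fps_nth C 1 = 0" "fps_nth C 2 = 0"
    using startsby_zero_power_prefix[of W 3] nth by (simp_all add: C_def)
  \<comment> \<open>Coefficient \<open>n\<close> on the left is \<open>n * fps_nth F n\<close>. The
    summand 1 in the second factor on the right contributes \<open>fps_nth F n\<close>, which leaves
    the factor \<open>n - 1\<close>.\<close>
  have "fps_nth F 2 = fps_nth W 1"
    using eq[of 2] nth cube
    by (simp add: fps_mult_nth sum.atLeast0_atMost_Suc eval_nat_numeral)
  moreover have "2 * fps_nth F 3 = fps_nth W 2 + fps_nth F 2 * fps_nth W 1"
    using eq[of 3] nth cube
    by (simp add: fps_mult_nth sum.atLeast0_atMost_Suc eval_nat_numeral)
  ultimately show "taylor_coeff f 2 = taylor_coeff w 1"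
    and "taylor_coeff f 3 = (taylor_coeff w 2 + (taylor_coeff w 1)\<^sup>2) / 2"
    by (simp_all add: taylor_coeff_def power2_eq_square field_simps flip: F_def W_def)
qed

text \<open>Same comparison for \<open>z f'' = f' (w - w^3/3)\<close>. As the series involved is
  that of \<open>f'\<close>, coefficients 1 and 2 of the equation already give coefficients 2 and 3
  of \<open>f\<close>.\<close>

lemma convex_coeffs:
  assumes f: "f \<in> normalized_analytic" and w: "w holomorphic_on unit_disk" "w 0 = 0"
    and q: "\<forall>z\<in>unit_disk. convex_quotient f z = phi_Ne (w z)"
  shows "taylor_coeff f 2 = taylor_coeff w 1 / 2"
    and "taylor_coeff f 3 = (taylor_coeff w 2 + (taylor_coeff w 1)\<^sup>2) / 6"
proof -
  define F where "F = fps_expansion f 0"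
  define W where "W = fps_expansion w 0"
  have F: "f has_fps_expansion F" and W: "w has_fps_expansion W"
    using f w by (auto simp: F_def W_def normalized_analytic_def
        intro!: has_fps_expansion_unit_disk)
  have nth: "fps_nth F 0 = 0" "fps_nth F 1 = 1" "fps_nth W 0 = 0"
    using f w by (auto simp: F_def W_def fps_expansion_def normalized_analytic_def)
  \<comment> \<open>By continuity and \<open>deriv f 0 = 1\<close>, the denominator
    \<open>deriv f\<close> is nonzero near 0.\<close>
  have "isCont (deriv f) 0"
    using has_fps_expansion_imp_continuous[OF has_fps_expansion_deriv[OF F]] by simp
  then have "\<forall>\<^sub>F z in at 0. deriv f z \<noteq> 0"
    using f by (intro tendsto_imp_eventually_ne[of _ 1])
      (auto simp: isCont_def normalized_analytic_def)
  then have ev: "\<forall>\<^sub>F z in nhds 0. z \<noteq> 0 \<longrightarrow> deriv f z \<noteq> 0"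
    by (simp add: eventually_at_filter)
  have "fps_X * fps_deriv (fps_deriv F) = fps_deriv F * (W - fps_const (1/3) * W ^ 3)"
  proof (rule has_fps_expansion_eq_nhds)
    show "(\<lambda>z. z * deriv (deriv f) z) has_fps_expansion fps_X * fps_deriv (fps_deriv F)"
      by (intro fps_expansion_intros F)
    show "(\<lambda>z. deriv f z * (w z - 1/3 * w z ^ 3)) has_fps_expansion
        fps_deriv F * (W - fps_const (1/3) * W ^ 3)"
      by (intro fps_expansion_intros F W)
    show "\<forall>\<^sub>F z in nhds 0. z * deriv (deriv f) z = deriv f z * (w z - 1/3 * w z ^ 3)"
      using ev eventually_unit_disk
    proof eventually_elim
      case (elim z)
      then show ?case
        using bspec[OF q elim(2)] w
        by (cases "z = 0")
           (auto simp: convex_quotient_def phi_Ne_def field_simps)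
    qed
  qed
  moreover define C where "C = W ^ 3"
  ultimately have eq: "fps_nth (fps_X * fps_deriv (fps_deriv F)) n
      = fps_nth (fps_deriv F * (W - fps_const (1/3) * C)) n" for n
    by simp
  have cube: "fps_nth C 0 = 0" "fps_nth C 1 = 0" "fps_nth C 2 = 0"
    using startsby_zero_power_prefix[of W 3] nth by (simp_all add: C_def)
  \<comment> \<open>The factors 2 and 6 are \<open>n * (n - 1)\<close> for \<open>n = 2\<close> and
    \<open>n = 3\<close>, from differentiating twice.\<close>
  have "2 * fps_nth F 2 = fps_nth W 1"
    using eq[of 1] nth cube
    by (simp add: fps_mult_nth sum.atLeast0_atMost_Suc eval_nat_numeral)
  moreover have "6 * fps_nth F 3 = fps_nth W 2 + 2 * fps_nth F 2 * fps_nth W 1"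
    using eq[of 2] nth cube
    by (simp add: fps_mult_nth sum.atLeast0_atMost_Suc eval_nat_numeral)
  ultimately show "taylor_coeff f 2 = taylor_coeff w 1 / 2"
    and "taylor_coeff f 3 = (taylor_coeff w 2 + (taylor_coeff w 1)\<^sup>2) / 6"
    by (simp_all add: taylor_coeff_def power2_eq_square field_simps flip: F_def W_def)
qed

section \<open>Bounds for the two classes\<close>

lemma starlike_Ne_bounds:
  assumes "f \<in> starlike_Ne"
  shows "norm (taylor_coeff f 2) \<le> 1"
    and "norm (taylor_coeff f 3 - \<mu> * (taylor_coeff f 2)\<^sup>2) \<le> 1 / 2 * max 1 (norm (2 * \<mu> - 1))"
proof -
  obtain w where f: "f \<in> normalized_analytic"
    and w: "w holomorphic_on unit_disk" "w 0 = 0" "\<forall>z\<in>unit_disk. norm (w z) < 1"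
    and q: "\<forall>z\<in>unit_disk. starlike_quotient f z = phi_Ne (w z)"
    using assms unfolding starlike_Ne_def subordinate_def by blast
  note coeffs = starlike_coeffs[OF f w(1,2) q]
  show "norm (taylor_coeff f 2) \<le> 1"
    using Schwarz_coeff_1[OF w] by (simp only: coeffs)
  \<comment> \<open>Completing to the form \<open>c2 - t * c1^2\<close> determines the parameter
    \<open>t = 2 * \<mu> - 1\<close>.\<close>
  have "taylor_coeff f 3 - \<mu> * (taylor_coeff f 2)\<^sup>2
      = (taylor_coeff w 2 - (2 * \<mu> - 1) * (taylor_coeff w 1)\<^sup>2) / 2"
    by (simp add: coeffs field_simps)
  then show "norm (taylor_coeff f 3 - \<mu> * (taylor_coeff f 2)\<^sup>2)
      \<le> 1 / 2 * max 1 (norm (2 * \<mu> - 1))"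
    using Schwarz_Fekete_Szego[OF w, of "2 * \<mu> - 1"] by (simp only: norm_divide) simp
qed

lemma convex_Ne_bounds:
  assumes "f \<in> convex_Ne"
  shows "norm (taylor_coeff f 2) \<le> 1 / 2"
    and "norm (taylor_coeff f 3 - \<mu> * (taylor_coeff f 2)\<^sup>2)
      \<le> 1 / 6 * max 1 (norm (3 / 2 * \<mu> - 1))"
proof -
  obtain w where f: "f \<in> normalized_analytic"
    and w: "w holomorphic_on unit_disk" "w 0 = 0" "\<forall>z\<in>unit_disk. norm (w z) < 1"
    and q: "\<forall>z\<in>unit_disk. convex_quotient f z = phi_Ne (w z)"
    using assms unfolding convex_Ne_def subordinate_def by blast
  note coeffs = convex_coeffs[OF f w(1,2) q]
  show "norm (taylor_coeff f 2) \<le> 1 / 2"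
    using Schwarz_coeff_1[OF w] unfolding coeffs by (simp add: norm_divide)
  \<comment> \<open>Since the second coefficient of \<open>f\<close> is \<open>c1 / 2\<close>, the
    term with \<open>\<mu>\<close> is \<open>\<mu> * c1^2 / 4\<close>; taking out
    \<open>1 / 6\<close> turns its factor into \<open>3 / 2 * \<mu>\<close>.\<close>
  have "taylor_coeff f 3 - \<mu> * (taylor_coeff f 2)\<^sup>2
      = (taylor_coeff w 2 - (3 / 2 * \<mu> - 1) * (taylor_coeff w 1)\<^sup>2) / 6"
    by (simp add: coeffs field_simps power2_eq_square)
  then show "norm (taylor_coeff f 3 - \<mu> * (taylor_coeff f 2)\<^sup>2)
      \<le> 1 / 6 * max 1 (norm (3 / 2 * \<mu> - 1))"
    using Schwarz_Fekete_Szego[OF w, of "3 / 2 * \<mu> - 1"] by (simp only: norm_divide) simp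
qed

section \<open>The extremal functions\<close>

lemma taylor_coeff_id: "taylor_coeff (\<lambda>z. z) n = (if n = 1 then 1 else 0)"
  using taylor_coeff_eqI[OF has_fps_expansion_fps_X] by (simp add: fps_X_def)

lemma phi_Ne_holomorphic: "phi_Ne holomorphic_on A"
  unfolding phi_Ne_def by (intro holomorphic_intros) auto

lemma subordinate_phi_NeI:
  assumes "\<And>z. z \<in> unit_disk \<Longrightarrow> q z = phi_Ne z"
  shows "subordinate q phi_Ne"
  unfolding subordinate_def
proof (intro conjI exI[of _ "\<lambda>z. z"] ballI)
  show "q holomorphic_on unit_disk"
    using holomorphic_cong[of unit_disk unit_disk q phi_Ne] assms phi_Ne_holomorphic by simp
qed (use assms phi_Ne_holomorphic in auto)

lemma f_Ne_has_field_derivative: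
  "(f_Ne has_field_derivative phi_Ne z * exp (z - z ^ 3 / 9)) (at z)"
  unfolding f_Ne_def phi_Ne_def
  by (auto intro!: derivative_eq_intros simp: field_simps power3_eq_cube power2_eq_square)

lemma f_Ne_normalized: "f_Ne \<in> normalized_analytic"
proof -
  have "f_Ne holomorphic_on unit_disk"
    using f_Ne_has_field_derivative by (auto simp: holomorphic_on_open)
  moreover have "f_Ne 0 = 0"
    by (simp add: f_Ne_def)
  moreover have "deriv f_Ne 0 = 1"
    using DERIV_imp_deriv[OF f_Ne_has_field_derivative[of 0]] by (simp add: phi_Ne_def)
  ultimately show ?thesis by (simp add: normalized_analytic_def)
qed

lemma starlike_quotient_f_Ne: "starlike_quotient f_Ne z = phi_Ne z"
  using f_Ne_has_field_derivative[THEN DERIV_imp_deriv, of z]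
  by (simp add: starlike_quotient_def f_Ne_def phi_Ne_def)

text \<open>The integrand is entire, so it has a primitive \<open>G\<close> on the convex set
  \<open>UNIV\<close>, and the integral along the segment from 0 to \<open>z\<close> is
  \<open>G z - G 0\<close>.\<close>

lemma f_hat_Ne_has_field_derivative:
  "(f_hat_Ne has_field_derivative exp (z - z ^ 3 / 9)) (at z)"
proof -
  have "(\<lambda>t. exp (t - t ^ 3 / 9)) holomorphic_on (UNIV :: complex set)"
    by (intro holomorphic_intros) auto
  then obtain G where G: "\<And>z::complex. (G has_field_derivative exp (z - z ^ 3 / 9)) (at z)"
  proof (rule holomorphic_convex_primitive'[OF convex_UNIV open_UNIV])
    fix g :: "complex \<Rightarrow> complex"
    assume "\<And>z. z \<in> UNIV \<Longrightarrow> (g has_field_derivative exp (z - z ^ 3 / 9)) (at z)"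
    from that[OF this[OF UNIV_I]] show thesis .
  qed
  have "f_hat_Ne = (\<lambda>z. G z - G 0)"
  proof
    fix z
    have "((\<lambda>t. exp (t - t ^ 3 / 9)) has_contour_integral
        G (pathfinish (linepath 0 z)) - G (pathstart (linepath 0 z))) (linepath 0 z)"
      by (rule contour_integral_primitive[OF G valid_path_linepath subset_UNIV])
    then have "((\<lambda>t. exp (t - t ^ 3 / 9)) has_contour_integral G z - G 0) (linepath 0 z)"
      by simp
    then show "f_hat_Ne z = G z - G 0"
      unfolding f_hat_Ne_def by (rule contour_integral_unique)
  qed
  moreover have "((\<lambda>z. G z - G 0) has_field_derivative exp (z - z ^ 3 / 9)) (at z)"
    using DERIV_diff[OF G DERIV_const] by simp
  ultimately show ?thesis by simp
qed

lemma deriv_f_hat_Ne: "deriv f_hat_Ne = (\<lambda>z. exp (z - z ^ 3 / 9))"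
  using f_hat_Ne_has_field_derivative DERIV_imp_deriv by blast

lemma f_hat_Ne_normalized: "f_hat_Ne \<in> normalized_analytic"
proof -
  have "f_hat_Ne holomorphic_on unit_disk"
    using f_hat_Ne_has_field_derivative by (auto simp: holomorphic_on_open)
  then show ?thesis
    by (simp add: normalized_analytic_def f_hat_Ne_def[of 0] deriv_f_hat_Ne)
qed

lemma convex_quotient_f_hat_Ne: "convex_quotient f_hat_Ne z = phi_Ne z"
proof -
  \<comment> \<open>The logarithmic derivative of the exponential is \<open>1 - z^2/3\<close>, and
    \<open>z\<close> times it is \<open>phi_Ne z - 1\<close>.\<close>
  have "((\<lambda>z. exp (z - z ^ 3 / 9)) has_field_derivative (1 - z\<^sup>2 / 3) * exp (z - z ^ 3 / 9)) (at z)"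
    by (auto intro!: derivative_eq_intros simp: field_simps)
  then show ?thesis
    by (simp add: convex_quotient_def deriv_f_hat_Ne DERIV_imp_deriv phi_Ne_def
        field_simps power3_eq_cube power2_eq_square)
qed

theorem theorem4p4:
  shows
    "(\<forall>f \<in> starlike_Ne.
        norm (taylor_coeff f 2) \<le> 1 \<and>
        norm (taylor_coeff f 3) \<le> 1 / 2 \<and>
        (\<forall>\<mu>::complex. norm (taylor_coeff f 3 - \<mu> * (taylor_coeff f 2)\<^sup>2)
              \<le> 1 / 2 * max 1 (norm (2 * \<mu> - 1))) \<and>
        norm (taylor_coeff f 3 - (taylor_coeff f 2)\<^sup>2) \<le> 1 / 2) \<and>
     (f_Ne \<in> starlike_Ne \<and>
        norm (taylor_coeff f_Ne 2) = 1 \<and>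
        norm (taylor_coeff f_Ne 3) = 1 / 2 \<and>
        norm (taylor_coeff f_Ne 3 - (taylor_coeff f_Ne 2)\<^sup>2) = 1 / 2) \<and>
     (\<forall>f \<in> convex_Ne.
        norm (taylor_coeff f 2) \<le> 1 / 2 \<and>
        norm (taylor_coeff f 3) \<le> 1 / 6 \<and>
        (\<forall>\<mu>::complex. norm (taylor_coeff f 3 - \<mu> * (taylor_coeff f 2)\<^sup>2)
              \<le> 1 / 6 * max 1 (norm (3 / 2 * \<mu> - 1)))) \<and>
     (f_hat_Ne \<in> convex_Ne \<and>
        norm (taylor_coeff f_hat_Ne 2) = 1 / 2 \<and>
        norm (taylor_coeff f_hat_Ne 3) = 1 / 6)"
proof (intro conjI ballI allI)
  fix f :: "complex \<Rightarrow> complex" and \<mu> :: complex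
  {
    assume f: "f \<in> starlike_Ne"
    show "norm (taylor_coeff f 2) \<le> 1"
      and "norm (taylor_coeff f 3 - \<mu> * (taylor_coeff f 2)\<^sup>2) \<le> 1 / 2 * max 1 (norm (2 * \<mu> - 1))"
      by (rule starlike_Ne_bounds[OF f])+
    show "norm (taylor_coeff f 3) \<le> 1 / 2"
      \<comment> \<open>Both \<open>\<mu> = 0\<close> and, below, \<open>\<mu> = 1\<close> make
        \<open>norm (2 * \<mu> - 1)\<close> equal to 1, so the maximum is 1.\<close>
      using starlike_Ne_bounds(2)[OF f, of 0] by simp
    show "norm (taylor_coeff f 3 - (taylor_coeff f 2)\<^sup>2) \<le> 1 / 2"
      using starlike_Ne_bounds(2)[OF f, of 1] by simp
  next
    assume f: "f \<in> convex_Ne"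
    show "norm (taylor_coeff f 2) \<le> 1 / 2"
      and "norm (taylor_coeff f 3 - \<mu> * (taylor_coeff f 2)\<^sup>2)
        \<le> 1 / 6 * max 1 (norm (3 / 2 * \<mu> - 1))"
      by (rule convex_Ne_bounds[OF f])+
    show "norm (taylor_coeff f 3) \<le> 1 / 6"
      using convex_Ne_bounds(2)[OF f, of 0] by simp
  }
next
  show "f_Ne \<in> starlike_Ne"
    by (simp add: starlike_Ne_def f_Ne_normalized subordinate_phi_NeI starlike_quotient_f_Ne)
  have "\<forall>z\<in>unit_disk. starlike_quotient f_Ne z = phi_Ne z"
    by (simp add: starlike_quotient_f_Ne)
  \<comment> \<open>The Schwarz function is the identity, with coefficients 1 and 0; hence
    \<open>f_Ne\<close> has coefficients 1 and \<open>1 / 2\<close>, and the difference in the last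
    claim is \<open>- 1 / 2\<close>.\<close>
  note coeffs = starlike_coeffs[OF f_Ne_normalized holomorphic_on_ident refl this]
  show "norm (taylor_coeff f_Ne 2) = 1" "norm (taylor_coeff f_Ne 3) = 1 / 2"
    "norm (taylor_coeff f_Ne 3 - (taylor_coeff f_Ne 2)\<^sup>2) = 1 / 2"
    by (simp_all add: coeffs taylor_coeff_id)
next
  show "f_hat_Ne \<in> convex_Ne"
    by (simp add: convex_Ne_def f_hat_Ne_normalized subordinate_phi_NeI convex_quotient_f_hat_Ne)
  have "\<forall>z\<in>unit_disk. convex_quotient f_hat_Ne z = phi_Ne z"
    by (simp add: convex_quotient_f_hat_Ne)
  note coeffs = convex_coeffs[OF f_hat_Ne_normalized holomorphic_on_ident refl this]
  show "norm (taylor_coeff f_hat_Ne 2) = 1 / 2" "norm (taylor_coeff f_hat_Ne 3) = 1 / 6"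
    by (simp_all add: coeffs taylor_coeff_id)
qed

end
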